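(* Let $\mathcal C$ be a balanced factorization category, $X$ an object of $\mathcal C$ and $x,y:1\to X$ points. The elements of the internal set $X(x,y)$ correspond bijectively to left arrows $x\to y$ and to right arrows $y\to x$ of $X$: $$\mathcal C(1,X(x,y))\cong\overline X(x,y)\cong\overline X'(y,x).$$ Explicitly, $\alpha\mapsto q_{x,y}\circ i_{x,y}\circ\alpha$ is a bijection from $\mathcal C(1,X(x,y))$ onto the set of maps $1\to X/y$ over the point $x$ of $X$, and $\alpha\mapsto p_{x,y}\circ e_{x,y}\circ\alpha$ is a bijection from $\mathcal C(1,X(x,y))$ onto the set of maps $1\to x\backslash X$ over the point $y$ of $X$.
   Context: A balanced factorization category is a finitely complete category $\mathcal C$ with two (orthogonal) factorization systems $(\mathcal E,\mathcal M)$ and $(\mathcal E',\mathcal M')$ such that $\mathcal M/1=\mathcal M'/1$ (an object $S$ has $S\to 1$ in $\mathcal M$ iff in $\mathcal M'$), and such that the pullback of a map in $\mathcal E$ along a map in $\mathcal M'$ is in $\mathcal E$, and the pullback of a map in $\mathcal E'$ along a map in $\mathcal M$ is in $\mathcal E'$. Factorizations are chosen. Internal sets are the objects $S$ with $S\to1$ in $\mathcal M$ (equivalently $\mathcal M'$); they form a reflective full subcategory $\mathcal S$ with reflection $\pi_0:\mathcal C\to\mathcal S$. A point $x:1\to X$ factors as $1\xrightarrow{e_x}X/x\xrightarrow{\downarrow x}X$ with $e_x\in\mathcal E$, $\downarrow x\in\mathcal M$ (slice), and as $1\xrightarrow{i_x}x\backslash X\xrightarrow{\uparrow x}X$ with $i_x\in\mathcal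 E'$, $\uparrow x\in\mathcal M'$ (coslice). A left arrow $x\to y$ is a map $\alpha:1\to X/y$ with $(\downarrow y)\alpha=x$; by orthogonality these correspond to the elements of $\overline X(x,y):=(\mathcal C/X)(X/x,X/y)$ via $u\mapsto u\circ e_x$. A right arrow $y\to x$ is a map $1\to x\backslash X$ whose composite with $\uparrow x$ is $y$; these correspond to the elements of $\overline X'(y,x):=(\mathcal C/X)(y\backslash X,x\backslash X)$ via $u\mapsto u\circ i_y$. $[x,y]$ is the pullback of $\uparrow x:x\backslash X\to X$ and $\downarrow y:X/y\to X$, with projections $p_{x,y}:[x,y]\to x\backslash X$ and $q_{x,y}:[x,y]\to X/y$; $X(x,y):=\pi_0[x,y]$ with reflection map $c_{x,y}:[x,y]\to X(x,y)$. Let $i:S\to[x,y]$ be the pullback of $i_x$ along $p_{x,y}$ and $e:S'\to[x,y]$ the pullback of $e_y$ along $q_{x,y}$; then $c_{x,y}i$ and $c_{x,y}e$ are isomorphisms, and one sets $i_{x,y}:=i(c_{x,y}i)^{-1}$, $e_{x,y}:=e(c_{x,y}e)^{-1}$, both maps $X(x,y)\to[x,y]$. *)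

theory Defs
  imports Main
begin

record ('o, 'a) category =
  Ob :: "'o set"
  Ar :: "'a set"
  Dom :: "'a \<Rightarrow> 'o"
  Cod :: "'a \<Rightarrow> 'o"
  Id :: "'o \<Rightarrow> 'a"
  Comp :: "'a \<Rightarrow> 'a \<Rightarrow> 'a"  (infixl "\<odot>\<index>" 70)

text \<open>Composition is in applicative order, and it is only meaningful on composable arrows.\<close>

definition hom :: "('o, 'a, 'z) category_scheme \<Rightarrow> 'o \<Rightarrow> 'o \<Rightarrow> 'a set" where
  "hom C a b = {f \<in> Ar C. Dom C f = a \<and> Cod C f = b}"

definition is_category :: "('o, 'a, 'z) category_scheme \<Rightarrow> bool" where
  "is_category C \<longleftrightarrow>
     (\<forall>f \<in> Ar C. Dom C f \<in> Ob C \<and> Cod C f \<in> Ob C) \<and>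
     (\<forall>a \<in> Ob C. Id C a \<in> hom C a a) \<and>
     (\<forall>f \<in> Ar C. \<forall>g \<in> Ar C. Cod C f = Dom C g \<longrightarrow>
        g \<odot>\<^bsub>C\<^esub> f \<in> hom C (Dom C f) (Cod C g)) \<and>
     (\<forall>f \<in> Ar C. f \<odot>\<^bsub>C\<^esub> Id C (Dom C f) = f \<and> Id C (Cod C f) \<odot>\<^bsub>C\<^esub> f = f) \<and>
     (\<forall>f \<in> Ar C. \<forall>g \<in> Ar C. \<forall>h \<in> Ar C. Cod C f = Dom C g \<longrightarrow> Cod C g = Dom C h \<longrightarrow>
        (h \<odot>\<^bsub>C\<^esub> g) \<odot>\<^bsub>C\<^esub> f = h \<odot>\<^bsub>C\<^esub> (g \<odot>\<^bsub>C\<^esub> f))"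

definition inverse_arrow :: "('o, 'a, 'z) category_scheme \<Rightarrow> 'a \<Rightarrow> 'a" where
  "inverse_arrow C f = (THE g. g \<in> hom C (Cod C f) (Dom C f) \<and>
     g \<odot>\<^bsub>C\<^esub> f = Id C (Dom C f) \<and> f \<odot>\<^bsub>C\<^esub> g = Id C (Cod C f))"

definition is_functor ::
  "('i, 'j, 'y) category_scheme \<Rightarrow> ('o, 'a, 'z) category_scheme \<Rightarrow> ('i \<Rightarrow> 'o) \<Rightarrow> ('j \<Rightarrow> 'a) \<Rightarrow> bool"
where
  "is_functor J C Fo Fa \<longleftrightarrow>
     (\<forall>j \<in> Ob J. Fo j \<in> Ob C) \<and>
     (\<forall>u \<in> Ar J. Fa u \<in> hom C (Fo (Dom J u)) (Fo (Cod J u))) \<and>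
     (\<forall>j \<in> Ob J. Fa (Id J j) = Id C (Fo j)) \<and>
     (\<forall>u \<in> Ar J. \<forall>v \<in> Ar J. Cod J u = Dom J v \<longrightarrow> Fa (v \<odot>\<^bsub>J\<^esub> u) = Fa v \<odot>\<^bsub>C\<^esub> Fa u)"

definition is_cone ::
  "('i, 'j, 'y) category_scheme \<Rightarrow> ('o, 'a, 'z) category_scheme \<Rightarrow> ('i \<Rightarrow> 'o) \<Rightarrow> ('j \<Rightarrow> 'a)
     \<Rightarrow> 'o \<Rightarrow> ('i \<Rightarrow> 'a) \<Rightarrow> bool"
where
  "is_cone J C Fo Fa L \<pi> \<longleftrightarrow> L \<in> Ob C \<and>
     (\<forall>j \<in> Ob J. \<pi> j \<in> hom C L (Fo j)) \<and>
     (\<forall>u \<in> Ar J. Fa u \<odot>\<^bsub>C\<^esub> \<pi> (Dom J u) = \<pi> (Cod J u))"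

definition is_limit ::
  "('i, 'j, 'y) category_scheme \<Rightarrow> ('o, 'a, 'z) category_scheme \<Rightarrow> ('i \<Rightarrow> 'o) \<Rightarrow> ('j \<Rightarrow> 'a)
     \<Rightarrow> 'o \<Rightarrow> ('i \<Rightarrow> 'a) \<Rightarrow> bool"
where
  "is_limit J C Fo Fa L \<pi> \<longleftrightarrow> is_cone J C Fo Fa L \<pi> \<and>
     (\<forall>N \<nu>. is_cone J C Fo Fa N \<nu> \<longrightarrow>
        (\<exists>!h. h \<in> hom C N L \<and> (\<forall>j \<in> Ob J. \<pi> j \<odot>\<^bsub>C\<^esub> h = \<nu> j)))"

text \<open>Every finite category is isomorphic to one whose objects and arrows are natural numbers.\<close>

definition finitely_complete :: "('o, 'a, 'z) category_scheme \<Rightarrow> bool" where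
  "finitely_complete C \<longleftrightarrow>
     (\<forall>(J :: (nat, nat) category) Fo Fa.
        is_category J \<longrightarrow> finite (Ob J) \<longrightarrow> finite (Ar J) \<longrightarrow> is_functor J C Fo Fa \<longrightarrow>
        (\<exists>L \<pi>. is_limit J C Fo Fa L \<pi>))"

definition is_terminal :: "('o, 'a, 'z) category_scheme \<Rightarrow> 'o \<Rightarrow> bool" where
  "is_terminal C t \<longleftrightarrow> t \<in> Ob C \<and> (\<forall>a \<in> Ob C. \<exists>!f. f \<in> hom C a t)"

text \<open>The square \<open>f \<odot> p = g \<odot> q\<close> with vertex \<open>P\<close> is a pullback;
  \<open>p\<close> is the pullback of \<open>g\<close> along \<open>f\<close>, and \<open>q\<close> the pullback of \<open>f\<close> along \<open>g\<close>.\<close>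

definition is_pullback ::
  "('o, 'a, 'z) category_scheme \<Rightarrow> 'a \<Rightarrow> 'a \<Rightarrow> 'o \<Rightarrow> 'a \<Rightarrow> 'a \<Rightarrow> bool"
where
  "is_pullback C f g P p q \<longleftrightarrow>
     f \<in> Ar C \<and> g \<in> Ar C \<and> Cod C f = Cod C g \<and>
     p \<in> hom C P (Dom C f) \<and> q \<in> hom C P (Dom C g) \<and> f \<odot>\<^bsub>C\<^esub> p = g \<odot>\<^bsub>C\<^esub> q \<and>
     (\<forall>T. \<forall>a \<in> hom C T (Dom C f). \<forall>b \<in> hom C T (Dom C g). f \<odot>\<^bsub>C\<^esub> a = g \<odot>\<^bsub>C\<^esub> b \<longrightarrow>
        (\<exists>!h. h \<in> hom C T P \<and> p \<odot>\<^bsub>C\<^esub> h = a \<and> q \<odot>\<^bsub>C\<^esub> h = b))"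

definition orthogonal :: "('o, 'a, 'z) category_scheme \<Rightarrow> 'a \<Rightarrow> 'a \<Rightarrow> bool" where
  "orthogonal C e m \<longleftrightarrow>
     (\<forall>a \<in> hom C (Dom C e) (Dom C m). \<forall>b \<in> hom C (Cod C e) (Cod C m).
        m \<odot>\<^bsub>C\<^esub> a = b \<odot>\<^bsub>C\<^esub> e \<longrightarrow>
        (\<exists>!d. d \<in> hom C (Cod C e) (Dom C m) \<and> d \<odot>\<^bsub>C\<^esub> e = a \<and> m \<odot>\<^bsub>C\<^esub> d = b))"

text \<open>An orthogonal factorization system with chosen factorizations \<open>f = mf f \<odot> ef f\<close>.\<close>

definition factorization_system ::
  "('o, 'a, 'z) category_scheme \<Rightarrow> 'a set \<Rightarrow> 'a set \<Rightarrow> ('a \<Rightarrow> 'a) \<Rightarrow> ('a \<Rightarrow> 'a) \<Rightarrow> bool"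
where
  "factorization_system C E M ef mf \<longleftrightarrow>
     E = {e \<in> Ar C. \<forall>m \<in> M. orthogonal C e m} \<and>
     M = {m \<in> Ar C. \<forall>e \<in> E. orthogonal C e m} \<and>
     (\<forall>f \<in> Ar C. ef f \<in> E \<and> mf f \<in> M \<and> Cod C (ef f) = Dom C (mf f) \<and> mf f \<odot>\<^bsub>C\<^esub> ef f = f)"

text \<open>\<open>efac\<close>, \<open>mfac\<close> are the chosen factorizations for \<open>(EE, MM)\<close>,
  and \<open>efac'\<close>, \<open>mfac'\<close> those for \<open>(EE', MM')\<close>.\<close>

record ('o, 'a) bf_category = "('o, 'a) category" +
  one :: 'o
  EE :: "'a set"
  MM :: "'a set"
  EE' :: "'a set"
  MM' :: "'a set"
  efac :: "'a \<Rightarrow> 'a"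
  mfac :: "'a \<Rightarrow> 'a"
  efac' :: "'a \<Rightarrow> 'a"
  mfac' :: "'a \<Rightarrow> 'a"

definition balanced_factorization_category :: "('o, 'a, 'z) bf_category_scheme \<Rightarrow> bool" where
  "balanced_factorization_category C \<longleftrightarrow>
     is_category C \<and> finitely_complete C \<and> is_terminal C (one C) \<and>
     factorization_system C (EE C) (MM C) (efac C) (mfac C) \<and>
     factorization_system C (EE' C) (MM' C) (efac' C) (mfac' C) \<and>
     (\<forall>S \<in> Ob C. \<forall>f \<in> hom C S (one C). f \<in> MM C \<longleftrightarrow> f \<in> MM' C) \<and>
     (\<forall>f \<in> EE C. \<forall>g \<in> MM' C. \<forall>P p q. is_pullback C f g P p q \<longrightarrow> q \<in> EE C) \<and>
     (\<forall>f \<in> EE' C. \<forall>g \<in> MM C. \<forall>P p q. is_pullback C f g P p q \<longrightarrow> q \<in> EE' C)"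

definition internal_set :: "('o, 'a, 'z) bf_category_scheme \<Rightarrow> 'o \<Rightarrow> bool" where
  "internal_set C S \<longleftrightarrow> S \<in> Ob C \<and> (\<exists>f \<in> hom C S (one C). f \<in> MM C)"

text \<open>\<open>c : Z \<rightarrow> R\<close> is a reflection of \<open>Z\<close> in the full subcategory of internal sets.\<close>

definition is_reflection :: "('o, 'a, 'z) bf_category_scheme \<Rightarrow> 'o \<Rightarrow> 'o \<Rightarrow> 'a \<Rightarrow> bool" where
  "is_reflection C Z R c \<longleftrightarrow> c \<in> hom C Z R \<and> internal_set C R \<and>
     (\<forall>T. internal_set C T \<longrightarrow>
        (\<forall>g \<in> hom C Z T. \<exists>!h. h \<in> hom C R T \<and> h \<odot>\<^bsub>C\<^esub> c = g))"

text \<open>For a point \<open>x : 1 \<rightarrow> X\<close>: the slice \<open>X/x\<close> with \<open>\<down>x\<close> and \<open>e\<^sub>x\<close>,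
  and the coslice \<open>x\X\<close> with \<open>\<up>x\<close> and \<open>i\<^sub>x\<close>.\<close>

definition slice_map :: "('o, 'a, 'z) bf_category_scheme \<Rightarrow> 'a \<Rightarrow> 'a" where
  "slice_map C x = mfac C x"

definition slice_point :: "('o, 'a, 'z) bf_category_scheme \<Rightarrow> 'a \<Rightarrow> 'a" where
  "slice_point C x = efac C x"

definition slice_ob :: "('o, 'a, 'z) bf_category_scheme \<Rightarrow> 'a \<Rightarrow> 'o" where
  "slice_ob C x = Dom C (slice_map C x)"

definition coslice_map :: "('o, 'a, 'z) bf_category_scheme \<Rightarrow> 'a \<Rightarrow> 'a" where
  "coslice_map C x = mfac' C x"

definition coslice_point :: "('o, 'a, 'z) bf_category_scheme \<Rightarrow> 'a \<Rightarrow> 'a" where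
  "coslice_point C x = efac' C x"

definition coslice_ob :: "('o, 'a, 'z) bf_category_scheme \<Rightarrow> 'a \<Rightarrow> 'o" where
  "coslice_ob C x = Dom C (coslice_map C x)"

definition left_arrows :: "('o, 'a, 'z) bf_category_scheme \<Rightarrow> 'a \<Rightarrow> 'a \<Rightarrow> 'a set" where
  "left_arrows C x y = {\<alpha> \<in> hom C (one C) (slice_ob C y). slice_map C y \<odot>\<^bsub>C\<^esub> \<alpha> = x}"

text \<open>Right arrows from \<open>y\<close> to \<open>x\<close>.\<close>

definition right_arrows :: "('o, 'a, 'z) bf_category_scheme \<Rightarrow> 'a \<Rightarrow> 'a \<Rightarrow> 'a set" where
  "right_arrows C y x = {\<alpha> \<in> hom C (one C) (coslice_ob C x). coslice_map C x \<odot>\<^bsub>C\<^esub> \<alpha> = y}"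

text \<open>The hom-set from \<open>f\<close> to \<open>g\<close> in \<open>C/X\<close>, where \<open>X\<close> is the common codomain of \<open>f\<close> and \<open>g\<close>.\<close>

definition over_hom :: "('o, 'a, 'z) category_scheme \<Rightarrow> 'a \<Rightarrow> 'a \<Rightarrow> 'a set" where
  "over_hom C f g = {u \<in> hom C (Dom C f) (Dom C g). g \<odot>\<^bsub>C\<^esub> u = f}"

definition left_hom :: "('o, 'a, 'z) bf_category_scheme \<Rightarrow> 'a \<Rightarrow> 'a \<Rightarrow> 'a set" where
  "left_hom C x y = over_hom C (slice_map C x) (slice_map C y)"

definition right_hom :: "('o, 'a, 'z) bf_category_scheme \<Rightarrow> 'a \<Rightarrow> 'a \<Rightarrow> 'a set" where
  "right_hom C y x = over_hom C (coslice_map C y) (coslice_map C x)"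

text \<open>\<open>s (c s)\<^sup>-\<^sup>1\<close>, used when \<open>c s\<close> is invertible: it turns \<open>s\<close> into a section of \<open>c\<close>.\<close>

definition section_of :: "('o, 'a, 'z) category_scheme \<Rightarrow> 'a \<Rightarrow> 'a \<Rightarrow> 'a" where
  "section_of C c s = s \<odot>\<^bsub>C\<^esub> inverse_arrow C (c \<odot>\<^bsub>C\<^esub> s)"

end

(* The pullback S of the slice X/y along the point x is an internal set, because M is stable
   under pullback, and the map i from S to [x,y] is in E', because E' is stable under pullback
   along M.  Maps in E' are orthogonal to internal sets, so S is itself a reflection of [x,y], and
   the points of S are visibly the left arrows from x to y.  The statement on right arrows is the
   same one with the two factorization systems interchanged. *)

theory Submission
  imports Defs
begin

section \<open>Typed arrows, isomorphisms and terminal objects\<close>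

lemma id_hom: "is_category C \<Longrightarrow> a \<in> Ob C \<Longrightarrow> Id C a \<in> hom C a a"
  by (simp add: is_category_def)

lemma comp_hom:
  "is_category C \<Longrightarrow> f \<in> hom C a b \<Longrightarrow> g \<in> hom C b d \<Longrightarrow> g \<odot>\<^bsub>C\<^esub> f \<in> hom C a d"
  by (auto simp: is_category_def hom_def)

lemma cat_comp_assoc:
  "is_category C \<Longrightarrow> f \<in> hom C a b \<Longrightarrow> g \<in> hom C b d \<Longrightarrow> h \<in> hom C d k \<Longrightarrow>
    (h \<odot>\<^bsub>C\<^esub> g) \<odot>\<^bsub>C\<^esub> f = h \<odot>\<^bsub>C\<^esub> (g \<odot>\<^bsub>C\<^esub> f)"
  by (simp add: is_category_def hom_def)

lemma comp_id_right: "is_category C \<Longrightarrow> f \<in> hom C a b \<Longrightarrow> f \<odot>\<^bsub>C\<^esub> Id C a = f"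
  by (auto simp: is_category_def hom_def)

lemma comp_id_left: "is_category C \<Longrightarrow> f \<in> hom C a b \<Longrightarrow> Id C b \<odot>\<^bsub>C\<^esub> f = f"
  by (auto simp: is_category_def hom_def)

lemma hom_obs: "is_category C \<Longrightarrow> f \<in> hom C a b \<Longrightarrow> a \<in> Ob C \<and> b \<in> Ob C"
  by (auto simp: is_category_def hom_def)

text \<open>Two-sided inverses are unique, so the definite description in
  \<open>inverse_arrow\<close> denotes whichever one is at hand. This is what makes
  \<open>section_of\<close> computable.\<close>

lemma inverse_arrow_eqI:
  assumes cat: "is_category C" and f: "f \<in> hom C a b" and g: "g \<in> hom C b a"
    and gf: "g \<odot>\<^bsub>C\<^esub> f = Id C a" and fg: "f \<odot>\<^bsub>C\<^esub> g = Id C b"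
  shows "inverse_arrow C f = g"
proof -
  have *: "Dom C f = a" "Cod C f = b" using f by (auto simp: hom_def)
  show ?thesis unfolding inverse_arrow_def *
  proof (rule the_equality)
    fix h assume h: "h \<in> hom C b a \<and> h \<odot>\<^bsub>C\<^esub> f = Id C a \<and> f \<odot>\<^bsub>C\<^esub> h = Id C b"
    then have "h = h \<odot>\<^bsub>C\<^esub> (f \<odot>\<^bsub>C\<^esub> g)" using comp_id_right[OF cat] by (metis fg)
    also have "\<dots> = g" using h cat_comp_assoc[OF cat g f, of h a] comp_id_left[OF cat g] by simp
    finally show "h = g" .
  qed (use g gf fg in auto)
qed

lemma bij_betw_comp_iso:
  assumes cat: "is_category C" and f: "f \<in> hom C a b" and g: "g \<in> hom C b a"
    and gf: "g \<odot>\<^bsub>C\<^esub> f = Id C a" and fg: "f \<odot>\<^bsub>C\<^esub> g = Id C b"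
  shows "bij_betw (\<lambda>\<alpha>. f \<odot>\<^bsub>C\<^esub> \<alpha>) (hom C t a) (hom C t b)"
proof (rule bij_betw_byWitness[where f' = "\<lambda>\<beta>. g \<odot>\<^bsub>C\<^esub> \<beta>"])
  show "\<forall>\<alpha>\<in>hom C t a. g \<odot>\<^bsub>C\<^esub> (f \<odot>\<^bsub>C\<^esub> \<alpha>) = \<alpha>"
    using cat_comp_assoc[OF cat _ f g] comp_id_left[OF cat] gf by metis
  show "\<forall>\<beta>\<in>hom C t b. f \<odot>\<^bsub>C\<^esub> (g \<odot>\<^bsub>C\<^esub> \<beta>) = \<beta>"
    using cat_comp_assoc[OF cat _ g f] comp_id_left[OF cat] fg by metis
qed (use comp_hom[OF cat _ f] comp_hom[OF cat _ g] in auto)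

lemma terminal_unique: "is_terminal C t \<Longrightarrow> is_category C \<Longrightarrow> f \<in> hom C a t \<Longrightarrow> g \<in> hom C a t \<Longrightarrow> f = g"
  unfolding is_terminal_def by (metis hom_obs)

section \<open>Pullbacks and their interaction with orthogonality\<close>

lemma pullback_sym: "is_pullback C f g P p q \<Longrightarrow> is_pullback C g f P q p"
  unfolding is_pullback_def by (auto simp: conj_commute)

lemma pullback_homs:
  assumes "is_pullback C f g P p q"
  shows "f \<in> hom C (Dom C f) (Cod C f)" "g \<in> hom C (Dom C g) (Cod C f)"
    "p \<in> hom C P (Dom C f)" "q \<in> hom C P (Dom C g)" "f \<odot>\<^bsub>C\<^esub> p = g \<odot>\<^bsub>C\<^esub> q"
  using assms by (auto simp: is_pullback_def hom_def)

lemma pullback_exists: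
  assumes "is_pullback C f g P p q" "a \<in> hom C T (Dom C f)" "b \<in> hom C T (Dom C g)"
    "f \<odot>\<^bsub>C\<^esub> a = g \<odot>\<^bsub>C\<^esub> b"
  obtains h where "h \<in> hom C T P" "p \<odot>\<^bsub>C\<^esub> h = a" "q \<odot>\<^bsub>C\<^esub> h = b"
  using assms unfolding is_pullback_def by blast

text \<open>Both arrows mediate the same commuting pair, and the mediating arrow is unique; thus the
  two projections are jointly monic.\<close>

lemma pullback_unique:
  assumes cat: "is_category C" and pb: "is_pullback C f g P p q"
    and h: "h \<in> hom C T P" and h': "h' \<in> hom C T P"
    and "p \<odot>\<^bsub>C\<^esub> h = p \<odot>\<^bsub>C\<^esub> h'" "q \<odot>\<^bsub>C\<^esub> h = q \<odot>\<^bsub>C\<^esub> h'"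
  shows "h = h'"
proof -
  note ph = pullback_homs[OF pb]
  have "f \<odot>\<^bsub>C\<^esub> (p \<odot>\<^bsub>C\<^esub> h) = g \<odot>\<^bsub>C\<^esub> (q \<odot>\<^bsub>C\<^esub> h)"
    using cat_comp_assoc[OF cat h ph(3,1)] cat_comp_assoc[OF cat h ph(4,2)] ph(5) by simp
  then have "\<exists>!k. k \<in> hom C T P \<and> p \<odot>\<^bsub>C\<^esub> k = p \<odot>\<^bsub>C\<^esub> h \<and> q \<odot>\<^bsub>C\<^esub> k = q \<odot>\<^bsub>C\<^esub> h"
    using pb comp_hom[OF cat h ph(3)] comp_hom[OF cat h ph(4)] unfolding is_pullback_def by blast
  then show ?thesis using assms by metis
qed

text \<open>Pasting a lifting problem against \<open>p\<close> with the pullback square yields one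
  against \<open>g\<close>. Its diagonal \<open>d\<close> agrees with \<open>b\<close> over the
  common codomain, so the two together induce a diagonal \<open>h\<close> into the pullback.\<close>

lemma orthogonal_pullback:
  assumes cat: "is_category C" and pb: "is_pullback C f g P p q"
    and e: "e \<in> Ar C" and orth: "orthogonal C e g"
  shows "orthogonal C e p"
  unfolding orthogonal_def
proof (intro ballI impI)
  note ph = pullback_homs[OF pb]
  have dp: "Dom C p = P" "Cod C p = Dom C f" and cg: "Cod C g = Cod C f"
    using ph by (auto simp: hom_def)
  have eh: "e \<in> hom C (Dom C e) (Cod C e)" using e by (simp add: hom_def)
  fix a b assume a: "a \<in> hom C (Dom C e) (Dom C p)" and b: "b \<in> hom C (Cod C e) (Cod C p)"
    and sq: "p \<odot>\<^bsub>C\<^esub> a = b \<odot>\<^bsub>C\<^esub> e"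
  note a = a[unfolded dp] and b = b[unfolded dp]
  have qa: "q \<odot>\<^bsub>C\<^esub> a \<in> hom C (Dom C e) (Dom C g)" by (rule comp_hom[OF cat a ph(4)])
  have fb: "f \<odot>\<^bsub>C\<^esub> b \<in> hom C (Cod C e) (Cod C g)" unfolding cg by (rule comp_hom[OF cat b ph(1)])
  have "g \<odot>\<^bsub>C\<^esub> (q \<odot>\<^bsub>C\<^esub> a) = (f \<odot>\<^bsub>C\<^esub> b) \<odot>\<^bsub>C\<^esub> e"
    using cat_comp_assoc[OF cat a ph(4,2)] cat_comp_assoc[OF cat a ph(3,1)] cat_comp_assoc[OF cat eh b ph(1)]
      ph(5) sq by simp
  then have ex1: "\<exists>!d. d \<in> hom C (Cod C e) (Dom C g) \<and> d \<odot>\<^bsub>C\<^esub> e = q \<odot>\<^bsub>C\<^esub> a \<and> g \<odot>\<^bsub>C\<^esub> d = f \<odot>\<^bsub>C\<^esub> b"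
    using orth qa fb unfolding orthogonal_def by blast
  then obtain d where d: "d \<in> hom C (Cod C e) (Dom C g)" "d \<odot>\<^bsub>C\<^esub> e = q \<odot>\<^bsub>C\<^esub> a" "g \<odot>\<^bsub>C\<^esub> d = f \<odot>\<^bsub>C\<^esub> b"
    by blast
  obtain h where h: "h \<in> hom C (Cod C e) P" "p \<odot>\<^bsub>C\<^esub> h = b" "q \<odot>\<^bsub>C\<^esub> h = d"
    using pullback_exists[OF pb b d(1) d(3)[symmetric]] .
  have he: "h \<odot>\<^bsub>C\<^esub> e = a"
    by (rule pullback_unique[OF cat pb comp_hom[OF cat eh h(1)] a])
      (use cat_comp_assoc[OF cat eh h(1) ph(3)] cat_comp_assoc[OF cat eh h(1) ph(4)] h sq d in simp_all)
  \<comment> \<open>A competing diagonal \<open>k\<close> followed by \<open>q\<close> solves the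
    pasted problem against \<open>g\<close>, hence equals \<open>d\<close>; joint monicity of the
    projections then gives \<open>k = h\<close>.\<close>
  have "k = h" if k: "k \<in> hom C (Cod C e) P" "k \<odot>\<^bsub>C\<^esub> e = a" "p \<odot>\<^bsub>C\<^esub> k = b" for k
  proof -
    have "g \<odot>\<^bsub>C\<^esub> (q \<odot>\<^bsub>C\<^esub> k) = f \<odot>\<^bsub>C\<^esub> b"
      using cat_comp_assoc[OF cat k(1) ph(4,2)] cat_comp_assoc[OF cat k(1) ph(3,1)] ph(5) k(3) by simp
    moreover have "(q \<odot>\<^bsub>C\<^esub> k) \<odot>\<^bsub>C\<^esub> e = q \<odot>\<^bsub>C\<^esub> a" using cat_comp_assoc[OF cat eh k(1) ph(4)] k(2) by simp
    ultimately have "q \<odot>\<^bsub>C\<^esub> k = d" using ex1 d comp_hom[OF cat k(1) ph(4)] by blast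
    then show ?thesis by (intro pullback_unique[OF cat pb k(1) h(1)]) (simp_all add: k h)
  qed
  then show "\<exists>!d. d \<in> hom C (Cod C e) (Dom C p) \<and> d \<odot>\<^bsub>C\<^esub> e = a \<and> p \<odot>\<^bsub>C\<^esub> d = b"
    unfolding dp using h he by blast
qed

section \<open>Factorization systems\<close>

lemma factorization_system_orthogonal:
  "factorization_system C E M ef mf \<Longrightarrow> e \<in> E \<Longrightarrow> m \<in> M \<Longrightarrow> orthogonal C e m"
  unfolding factorization_system_def by blast

text \<open>\<open>M\<close> consists of all arrows right orthogonal to \<open>E\<close>, and
  orthogonality against a fixed arrow passes to pullbacks.\<close>

lemma factorization_system_pullback:
  assumes cat: "is_category C" and fs: "factorization_system C E M ef mf"
    and pb: "is_pullback C f g P p q" and g: "g \<in> M"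
  shows "p \<in> M"
proof -
  have E: "E \<subseteq> Ar C" and M: "M = {m \<in> Ar C. \<forall>e \<in> E. orthogonal C e m}"
    using fs unfolding factorization_system_def by blast+
  have "p \<in> Ar C" using pullback_homs(3)[OF pb] by (simp add: hom_def)
  moreover have "\<forall>e \<in> E. orthogonal C e p"
    using orthogonal_pullback[OF cat pb] E g M by blast
  ultimately show ?thesis by (subst M) simp
qed

lemma factorization_homs:
  assumes cat: "is_category C" and fs: "factorization_system C E M ef mf" and x: "x \<in> hom C a b"
  shows "ef x \<in> hom C a (Dom C (mf x))" "mf x \<in> hom C (Dom C (mf x)) b"
    "ef x \<in> E" "mf x \<in> M" "mf x \<odot>\<^bsub>C\<^esub> ef x = x"
proof -
  have xA: "x \<in> Ar C" using x by (simp add: hom_def)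
  show *: "ef x \<in> E" "mf x \<in> M" "mf x \<odot>\<^bsub>C\<^esub> ef x = x"
    using fs xA unfolding factorization_system_def by blast+
  have "E \<subseteq> Ar C" "M \<subseteq> Ar C" "Cod C (ef x) = Dom C (mf x)"
    using fs xA unfolding factorization_system_def by blast+
  then have e: "ef x \<in> hom C (Dom C (ef x)) (Dom C (mf x))" and m: "mf x \<in> hom C (Dom C (mf x)) (Cod C (mf x))"
    using * by (auto simp: hom_def)
  \<comment> \<open>The definition only matches the middle object of the factorization; the outer
    endpoints are recovered from those of the composite, which is \<open>x\<close>.\<close>
  have "x \<in> hom C (Dom C (ef x)) (Cod C (mf x))" using comp_hom[OF cat e m] *(3) by simp
  with x e m show "ef x \<in> hom C a (Dom C (mf x))" "mf x \<in> hom C (Dom C (mf x)) b"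
    by (auto simp: hom_def)
qed

text \<open>An arrow \<open>u\<close> over \<open>b\<close> with \<open>u\<close> after
  \<open>e\<close> equal to \<alpha> is exactly a diagonal of the square with sides
  \<open>e\<close>, \<open>n\<close>, \<alpha> and \<open>m\<close>, so orthogonality supplies one
  and only one. Applied to the factorization of a point, this is a Yoneda lemma for slices.\<close>

lemma bij_betw_over_hom_precomp:
  assumes cat: "is_category C" and e: "e \<in> hom C a d" and m: "m \<in> hom C d b"
    and n: "n \<in> hom C k b" and orth: "orthogonal C e n"
  shows "bij_betw (\<lambda>u. u \<odot>\<^bsub>C\<^esub> e) (over_hom C m n) {\<alpha> \<in> hom C a k. n \<odot>\<^bsub>C\<^esub> \<alpha> = m \<odot>\<^bsub>C\<^esub> e}"
proof (rule bij_betwI')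
  have D: "Dom C e = a" "Cod C e = d" "Dom C m = d" "Dom C n = k" "Cod C n = b"
    using e m n by (auto simp: hom_def)
  have u1: "u \<in> hom C d k" "n \<odot>\<^bsub>C\<^esub> u = m" "u \<odot>\<^bsub>C\<^esub> e \<in> hom C a k" "n \<odot>\<^bsub>C\<^esub> (u \<odot>\<^bsub>C\<^esub> e) = m \<odot>\<^bsub>C\<^esub> e"
    if "u \<in> over_hom C m n" for u
    using that comp_hom[OF cat e, of u k] cat_comp_assoc[OF cat e _ n, of u] by (auto simp: over_hom_def D)
  have ex1: "\<exists>!u. u \<in> hom C d k \<and> u \<odot>\<^bsub>C\<^esub> e = \<alpha> \<and> n \<odot>\<^bsub>C\<^esub> u = m"
    if "\<alpha> \<in> hom C a k" "n \<odot>\<^bsub>C\<^esub> \<alpha> = m \<odot>\<^bsub>C\<^esub> e" for \<alpha>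
    using orth that m unfolding orthogonal_def D by blast
  show "(u \<odot>\<^bsub>C\<^esub> e = v \<odot>\<^bsub>C\<^esub> e) = (u = v)" if "u \<in> over_hom C m n" "v \<in> over_hom C m n" for u v
    using ex1[OF u1(3,4)] u1 that by metis
  show "u \<odot>\<^bsub>C\<^esub> e \<in> {\<alpha> \<in> hom C a k. n \<odot>\<^bsub>C\<^esub> \<alpha> = m \<odot>\<^bsub>C\<^esub> e}" if "u \<in> over_hom C m n" for u
    using u1[OF that] by simp
  show "\<exists>u\<in>over_hom C m n. \<alpha> = u \<odot>\<^bsub>C\<^esub> e" if "\<alpha> \<in> {\<alpha> \<in> hom C a k. n \<odot>\<^bsub>C\<^esub> \<alpha> = m \<odot>\<^bsub>C\<^esub> e}" for \<alpha>
    using ex1[of \<alpha>] that by (auto simp: over_hom_def D)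
qed

section \<open>Internal sets and their reflections\<close>

lemma bfc_dest:
  assumes "balanced_factorization_category C"
  shows "is_category C" "is_terminal C (one C)"
    "factorization_system C (EE C) (MM C) (efac C) (mfac C)"
    "factorization_system C (EE' C) (MM' C) (efac' C) (mfac' C)"
  using assms by (auto simp: balanced_factorization_category_def)

text \<open>The arrow from \<open>T\<close> to the terminal object lies in \<open>MM'\<close> as
  well as in \<open>MM\<close>, hence is orthogonal to \<open>i\<close>. The lower triangle of the
  lifting problem commutes automatically, so a diagonal is merely an extension along
  \<open>i\<close>.\<close>

lemma EE'_extend_internal_set:
  assumes bfc: "balanced_factorization_category C"
    and i: "i \<in> EE' C" "i \<in> hom C S P" and T: "internal_set C T" and g: "g \<in> hom C S T"
  shows "\<exists>!h. h \<in> hom C P T \<and> h \<odot>\<^bsub>C\<^esub> i = g"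
proof -
  note cat = bfc_dest(1)[OF bfc] and one_terminal = bfc_dest(2)[OF bfc]
  obtain m where m: "m \<in> hom C T (one C)" "m \<in> MM C" and "T \<in> Ob C"
    using T by (auto simp: internal_set_def)
  then have "m \<in> MM' C" using bfc unfolding balanced_factorization_category_def by blast
  then have orth: "orthogonal C i m"
    using factorization_system_orthogonal[OF bfc_dest(4)[OF bfc] i(1)] by simp
  obtain b where b: "b \<in> hom C P (one C)"
    using one_terminal hom_obs[OF cat i(2)] unfolding is_terminal_def by blast
  have D: "Dom C i = S" "Cod C i = P" "Dom C m = T" "Cod C m = one C"
    using i m by (auto simp: hom_def)
  have "m \<odot>\<^bsub>C\<^esub> g = b \<odot>\<^bsub>C\<^esub> i"
    by (rule terminal_unique[OF one_terminal cat comp_hom[OF cat g m(1)] comp_hom[OF cat i(2) b]])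
  then have "\<exists>!h. h \<in> hom C P T \<and> h \<odot>\<^bsub>C\<^esub> i = g \<and> m \<odot>\<^bsub>C\<^esub> h = b"
    using orth g b unfolding orthogonal_def D by blast
  moreover have "m \<odot>\<^bsub>C\<^esub> h = b" if "h \<in> hom C P T" for h
    by (rule terminal_unique[OF one_terminal cat comp_hom[OF cat that m(1)] b])
  ultimately show ?thesis by metis
qed

text \<open>Extending the identity of \<open>S\<close> along \<open>i\<close> gives a retraction
  \<open>r\<close>, and \<open>r\<close> factors through the reflection \<open>c\<close> as
  \<open>g\<close> after \<open>c\<close>. This \<open>g\<close> is the inverse.\<close>

lemma reflection_comp_EE'_iso:
  assumes bfc: "balanced_factorization_category C"
    and i: "i \<in> EE' C" "i \<in> hom C S P" and S: "internal_set C S" and refl: "is_reflection C P R c"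
  obtains g where "g \<in> hom C R S" "g \<odot>\<^bsub>C\<^esub> (c \<odot>\<^bsub>C\<^esub> i) = Id C S" "(c \<odot>\<^bsub>C\<^esub> i) \<odot>\<^bsub>C\<^esub> g = Id C R"
proof -
  note cat = bfc_dest(1)[OF bfc]
  have c: "c \<in> hom C P R" and R: "internal_set C R"
    and univ: "\<And>T g. internal_set C T \<Longrightarrow> g \<in> hom C P T \<Longrightarrow> \<exists>!h. h \<in> hom C R T \<and> h \<odot>\<^bsub>C\<^esub> c = g"
    using refl unfolding is_reflection_def by blast+
  have SO: "S \<in> Ob C" and RO: "R \<in> Ob C" using S R by (simp_all add: internal_set_def)
  obtain r where r: "r \<in> hom C P S" "r \<odot>\<^bsub>C\<^esub> i = Id C S"
    using EE'_extend_internal_set[OF bfc i S id_hom[OF cat SO]] by blast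
  obtain g where g: "g \<in> hom C R S" "g \<odot>\<^bsub>C\<^esub> c = r" using univ[OF S r(1)] by blast
  have ci: "c \<odot>\<^bsub>C\<^esub> i \<in> hom C S R" by (rule comp_hom[OF cat i(2) c])
  have gci: "g \<odot>\<^bsub>C\<^esub> (c \<odot>\<^bsub>C\<^esub> i) = Id C S" using cat_comp_assoc[OF cat i(2) c g(1)] g(2) r(2) by simp
  let ?k = "(c \<odot>\<^bsub>C\<^esub> i) \<odot>\<^bsub>C\<^esub> g"
  have k: "?k \<in> hom C R R" by (rule comp_hom[OF cat g(1) ci])
  have kc: "?k \<odot>\<^bsub>C\<^esub> c \<in> hom C P R" by (rule comp_hom[OF cat c k])
  have "(?k \<odot>\<^bsub>C\<^esub> c) \<odot>\<^bsub>C\<^esub> i = c \<odot>\<^bsub>C\<^esub> i"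
    using cat_comp_assoc[OF cat i(2) c k] cat_comp_assoc[OF cat ci g(1) ci] gci comp_id_right[OF cat ci] by simp
  \<comment> \<open>Both sides extend the same arrow along \<open>i\<close> into the internal set
    \<open>R\<close>. Uniqueness in the universal property of \<open>c\<close> then turns
    \<open>?k\<close> into the identity.\<close>
  then have "?k \<odot>\<^bsub>C\<^esub> c = c"
    using EE'_extend_internal_set[OF bfc i R ci] kc c by blast
  moreover have "Id C R \<odot>\<^bsub>C\<^esub> c = c" by (rule comp_id_left[OF cat c])
  ultimately have "?k = Id C R"
    using univ[OF R c] k id_hom[OF cat RO] by blast
  with g(1) gci show thesis by (rule that)
qed

section \<open>Left arrows as arrows between slices and as points of the internal hom\<close>

lemma left_hom_bij_left_arrows:
  assumes bfc: "balanced_factorization_category C"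
    and x: "x \<in> hom C (one C) X" and y: "y \<in> hom C (one C) X"
  shows "bij_betw (\<lambda>u. u \<odot>\<^bsub>C\<^esub> slice_point C x) (left_hom C x y) (left_arrows C x y)"
proof -
  note cat = bfc_dest(1)[OF bfc] and fs = bfc_dest(3)[OF bfc]
  note fx = factorization_homs[OF cat fs x] and fy = factorization_homs[OF cat fs y]
  show ?thesis
    using bij_betw_over_hom_precomp[OF cat fx(1,2) fy(2) factorization_system_orthogonal[OF fs fx(3) fy(4)]]
    by (simp add: fx(5) left_hom_def left_arrows_def slice_map_def slice_point_def slice_ob_def)
qed

text \<open>Points of \<open>S\<close> correspond to points of \<open>P\<close> lying over the
  chosen point of the coslice, that is, to their second components in \<open>X/y\<close>. The
  isomorphism between \<open>R\<close> and \<open>S\<close> transports this to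
  \<open>R\<close>.\<close>

lemma points_bij_left_arrows:
  assumes bfc: "balanced_factorization_category C"
    and x: "x \<in> hom C (one C) X" and y: "y \<in> hom C (one C) X"
    and pb: "is_pullback C (coslice_map C x) (slice_map C y) P p q"
    and refl: "is_reflection C P R c"
    and pbi: "is_pullback C p (coslice_point C x) S i s"
  shows "bij_betw (\<lambda>\<alpha>. q \<odot>\<^bsub>C\<^esub> section_of C c i \<odot>\<^bsub>C\<^esub> \<alpha>) (hom C (one C) R) (left_arrows C x y)"
proof -
  note cat = bfc_dest(1)[OF bfc] and one_terminal = bfc_dest(2)[OF bfc]
  note fx = factorization_homs[OF cat bfc_dest(4)[OF bfc] x, folded coslice_map_def coslice_point_def]
  note fy = factorization_homs[OF cat bfc_dest(3)[OF bfc] y, folded slice_map_def slice_point_def]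
  note ph = pullback_homs[OF pb] and pih = pullback_homs[OF pbi]
  have D: "Dom C p = P" "Dom C (coslice_point C x) = one C" using ph(3) fx(1) by (auto simp: hom_def)
  have i: "i \<in> hom C S P" and s: "s \<in> hom C S (one C)" using pih D by simp_all
  have oneO: "one C \<in> Ob C" using one_terminal by (simp add: is_terminal_def)

  \<comment> \<open>As a pullback of the slice map of \<open>y\<close>, \<open>p\<close> is in
    \<open>MM\<close>. This allows the balance axiom to put \<open>i\<close> in \<open>EE'\<close>,
    and it puts \<open>s\<close>, whose codomain is terminal, in \<open>MM\<close>.\<close>
  have pM: "p \<in> MM C" by (rule factorization_system_pullback[OF cat bfc_dest(3)[OF bfc] pb fy(4)])
  have iE: "i \<in> EE' C"
    using bfc pullback_sym[OF pbi] pM fx(3) unfolding balanced_factorization_category_def by blast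
  have "s \<in> MM C"
    by (rule factorization_system_pullback[OF cat bfc_dest(3)[OF bfc] pullback_sym[OF pbi] pM])
  then have S: "internal_set C S" using s hom_obs[OF cat s] by (auto simp: internal_set_def)
  have c: "c \<in> hom C P R" using refl by (simp add: is_reflection_def)
  have ci: "c \<odot>\<^bsub>C\<^esub> i \<in> hom C S R" by (rule comp_hom[OF cat i c])
  obtain g where g: "g \<in> hom C R S" "g \<odot>\<^bsub>C\<^esub> (c \<odot>\<^bsub>C\<^esub> i) = Id C S" "(c \<odot>\<^bsub>C\<^esub> i) \<odot>\<^bsub>C\<^esub> g = Id C R"
    by (rule reflection_comp_EE'_iso[OF bfc iE i S refl])
  have sec: "section_of C c i = i \<odot>\<^bsub>C\<^esub> g"
    unfolding section_of_def using inverse_arrow_eqI[OF cat ci g] by simp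

  have "bij_betw (\<lambda>\<beta>. q \<odot>\<^bsub>C\<^esub> (i \<odot>\<^bsub>C\<^esub> \<beta>)) (hom C (one C) S) (left_arrows C x y)"
  proof (rule bij_betwI')
    fix \<beta> \<gamma> assume b: "\<beta> \<in> hom C (one C) S" and b': "\<gamma> \<in> hom C (one C) S"
    \<comment> \<open>Injectivity: the components along \<open>s\<close> agree by terminality, hence
      so do those along \<open>p\<close>. Joint monicity is then used twice, first for
      \<open>P\<close> and then for \<open>S\<close>.\<close>
    have "s \<odot>\<^bsub>C\<^esub> \<beta> = s \<odot>\<^bsub>C\<^esub> \<gamma>"
      by (rule terminal_unique[OF one_terminal cat comp_hom[OF cat b s] comp_hom[OF cat b' s]])
    moreover from this have "p \<odot>\<^bsub>C\<^esub> (i \<odot>\<^bsub>C\<^esub> \<beta>) = p \<odot>\<^bsub>C\<^esub> (i \<odot>\<^bsub>C\<^esub> \<gamma>)"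
      using cat_comp_assoc[OF cat b i ph(3)] cat_comp_assoc[OF cat b' i ph(3)]
        cat_comp_assoc[OF cat b s fx(1)] cat_comp_assoc[OF cat b' s fx(1)] pih(5) by simp
    ultimately show "(q \<odot>\<^bsub>C\<^esub> (i \<odot>\<^bsub>C\<^esub> \<beta>) = q \<odot>\<^bsub>C\<^esub> (i \<odot>\<^bsub>C\<^esub> \<gamma>)) = (\<beta> = \<gamma>)"
      using pullback_unique[OF cat pb comp_hom[OF cat b i] comp_hom[OF cat b' i]]
        pullback_unique[OF cat pbi b b'] by blast
  next
    fix \<beta> assume b: "\<beta> \<in> hom C (one C) S"
    have ib: "i \<odot>\<^bsub>C\<^esub> \<beta> \<in> hom C (one C) P" by (rule comp_hom[OF cat b i])
    have sb: "s \<odot>\<^bsub>C\<^esub> \<beta> = Id C (one C)"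
      by (rule terminal_unique[OF one_terminal cat comp_hom[OF cat b s] id_hom[OF cat oneO]])
    have "p \<odot>\<^bsub>C\<^esub> (i \<odot>\<^bsub>C\<^esub> \<beta>) = coslice_point C x"
      using cat_comp_assoc[OF cat b i ph(3)] cat_comp_assoc[OF cat b s fx(1)] pih(5) sb
        comp_id_right[OF cat fx(1)] by simp
    then have "slice_map C y \<odot>\<^bsub>C\<^esub> (q \<odot>\<^bsub>C\<^esub> (i \<odot>\<^bsub>C\<^esub> \<beta>)) = x"
      using cat_comp_assoc[OF cat ib ph(3,1)] cat_comp_assoc[OF cat ib ph(4,2)] ph(5) fx(5) by simp
    then show "q \<odot>\<^bsub>C\<^esub> (i \<odot>\<^bsub>C\<^esub> \<beta>) \<in> left_arrows C x y"
      using comp_hom[OF cat ib ph(4)] by (simp add: left_arrows_def slice_ob_def)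
  next
    fix \<alpha> assume "\<alpha> \<in> left_arrows C x y"
    then have a: "\<alpha> \<in> hom C (one C) (Dom C (slice_map C y))" and ax: "slice_map C y \<odot>\<^bsub>C\<^esub> \<alpha> = x"
      by (simp_all add: left_arrows_def slice_ob_def)
    \<comment> \<open>Surjectivity: the chosen point of the coslice and \<alpha> both lie over
      \<open>x\<close>, so they form a point of \<open>P\<close>, which lifts to \<open>S\<close>
      with the identity as its other component.\<close>
    obtain h where h: "h \<in> hom C (one C) P" "p \<odot>\<^bsub>C\<^esub> h = coslice_point C x" "q \<odot>\<^bsub>C\<^esub> h = \<alpha>"
      by (rule pullback_exists[OF pb fx(1) a]) (simp_all add: ax fx(5))
    have "p \<odot>\<^bsub>C\<^esub> h = coslice_point C x \<odot>\<^bsub>C\<^esub> Id C (one C)"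
      using h(2) comp_id_right[OF cat fx(1)] by simp
    then obtain \<beta> where "\<beta> \<in> hom C (one C) S" "i \<odot>\<^bsub>C\<^esub> \<beta> = h"
      using pullback_exists[OF pbi, unfolded D, OF h(1) id_hom[OF cat oneO]] by blast
    with h(3) show "\<exists>\<beta>\<in>hom C (one C) S. \<alpha> = q \<odot>\<^bsub>C\<^esub> (i \<odot>\<^bsub>C\<^esub> \<beta>)" by auto
  qed
  with bij_betw_comp_iso[OF cat g(1) ci g(3,2)]
  have "bij_betw ((\<lambda>\<beta>. q \<odot>\<^bsub>C\<^esub> (i \<odot>\<^bsub>C\<^esub> \<beta>)) \<circ> (\<lambda>\<alpha>. g \<odot>\<^bsub>C\<^esub> \<alpha>)) (hom C (one C) R) (left_arrows C x y)"
    by (rule bij_betw_trans)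
  \<comment> \<open>Composition associates to the left in the goal, so the composite of the two
    bijections must be rebracketed.\<close>
  moreover have "q \<odot>\<^bsub>C\<^esub> (i \<odot>\<^bsub>C\<^esub> (g \<odot>\<^bsub>C\<^esub> \<alpha>)) = q \<odot>\<^bsub>C\<^esub> section_of C c i \<odot>\<^bsub>C\<^esub> \<alpha>" if "\<alpha> \<in> hom C (one C) R" for \<alpha>
    using cat_comp_assoc[OF cat that g(1) i] cat_comp_assoc[OF cat that comp_hom[OF cat g(1) i] ph(4)] sec by simp
  ultimately show ?thesis by (simp cong: bij_betw_cong)
qed

section \<open>Duality: exchanging the two factorization systems\<close>

definition swap_systems :: "('o, 'a, 'z) bf_category_scheme \<Rightarrow> ('o, 'a, 'z) bf_category_scheme" where
  "swap_systems C = C\<lparr>EE := EE' C, MM := MM' C, EE' := EE C, MM' := MM C,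
     efac := efac' C, mfac := mfac' C, efac' := efac C, mfac' := mfac C\<rparr>"

lemma swap_systems_simps [simp]:
  "Ob (swap_systems C) = Ob C" "Ar (swap_systems C) = Ar C" "Dom (swap_systems C) = Dom C"
  "Cod (swap_systems C) = Cod C" "Id (swap_systems C) = Id C" "Comp (swap_systems C) = Comp C"
  "one (swap_systems C) = one C" "EE (swap_systems C) = EE' C" "MM (swap_systems C) = MM' C"
  "EE' (swap_systems C) = EE C" "MM' (swap_systems C) = MM C"
  "efac (swap_systems C) = efac' C" "mfac (swap_systems C) = mfac' C"
  "efac' (swap_systems C) = efac C" "mfac' (swap_systems C) = mfac C"
  by (simp_all add: swap_systems_def)

text \<open>These notions see the structure only through the underlying category;
  \<open>factorization_system\<close> receives its classes as arguments.\<close>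

lemma swap_systems_category_notions [simp]:
  "hom (swap_systems C) = hom C" "is_category (swap_systems C) = is_category C"
  "is_terminal (swap_systems C) = is_terminal C" "is_pullback (swap_systems C) = is_pullback C"
  "orthogonal (swap_systems C) = orthogonal C"
  "factorization_system (swap_systems C) = factorization_system C"
  "finitely_complete (swap_systems C) = finitely_complete C"
  "section_of (swap_systems C) = section_of C"
  "over_hom (swap_systems C) = over_hom C"
proof -
  show h: "hom (swap_systems C) = hom C" by (intro ext) (simp add: hom_def)
  show "is_category (swap_systems C) = is_category C" by (simp add: is_category_def h)
  show "is_terminal (swap_systems C) = is_terminal C" by (intro ext) (simp add: is_terminal_def h)
  show "is_pullback (swap_systems C) = is_pullback C" by (intro ext) (simp add: is_pullback_def h)
  show o: "orthogonal (swap_systems C) = orthogonal C" by (intro ext) (simp add: orthogonal_def h)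
  show "factorization_system (swap_systems C) = factorization_system C"
    by (intro ext) (simp add: factorization_system_def o)
  show "finitely_complete (swap_systems C) = finitely_complete C"
    by (simp add: finitely_complete_def is_functor_def is_limit_def is_cone_def h)
  show "section_of (swap_systems C) = section_of C"
    by (intro ext) (simp add: section_of_def inverse_arrow_def h)
  show "over_hom (swap_systems C) = over_hom C" by (intro ext) (simp add: over_hom_def h)
qed

lemma swap_systems_slices [simp]:
  "slice_map (swap_systems C) = coslice_map C" "slice_point (swap_systems C) = coslice_point C"
  "coslice_map (swap_systems C) = slice_map C" "coslice_point (swap_systems C) = slice_point C"
  "left_arrows (swap_systems C) y x = right_arrows C y x"
  "left_hom (swap_systems C) y x = right_hom C y x"
  by (auto simp: fun_eq_iff slice_map_def slice_point_def coslice_map_def coslice_point_def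
      slice_ob_def coslice_ob_def left_arrows_def right_arrows_def left_hom_def right_hom_def)

text \<open>The axioms come in mirror pairs, and the condition on arrows into the terminal object is
  symmetric.\<close>

lemma swap_systems_bfc:
  assumes "balanced_factorization_category C"
  shows "balanced_factorization_category (swap_systems C)"
  using assms by (simp add: balanced_factorization_category_def)

text \<open>\<open>internal_set\<close> is stated through \<open>MM\<close>, which becomes
  \<open>MM'\<close> after the exchange; the two classes agree over the terminal object, so the
  internal sets stay the same.\<close>

lemma swap_systems_reflection:
  assumes "balanced_factorization_category C"
  shows "is_reflection (swap_systems C) Z R c = is_reflection C Z R c"
proof -
  have "internal_set (swap_systems C) T = internal_set C T" for T
    using assms by (auto simp: internal_set_def balanced_factorization_category_def)
  then show ?thesis by (simp add: is_reflection_def)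
qed

section \<open>Assembling the three bijections\<close>

theorem mainTheorem10:
  fixes C :: "('o, 'a) bf_category"
    and X P Xxy S S' :: 'o
    and x y p q c i s e t ixy exy :: 'a
  assumes "balanced_factorization_category C"
    and "X \<in> Ob C"
    and "x \<in> hom C (one C) X"
    and "y \<in> hom C (one C) X"
    and "is_pullback C (coslice_map C x) (slice_map C y) P p q"
    and "is_reflection C P Xxy c"
    and "is_pullback C p (coslice_point C x) S i s"
    and "is_pullback C q (slice_point C y) S' e t"
    and "ixy = section_of C c i"
    and "exy = section_of C c e"
  shows "bij_betw (\<lambda>\<alpha>. q \<odot>\<^bsub>C\<^esub> ixy \<odot>\<^bsub>C\<^esub> \<alpha>) (hom C (one C) Xxy) (left_arrows C x y)
    \<and> bij_betw (\<lambda>\<alpha>. p \<odot>\<^bsub>C\<^esub> exy \<odot>\<^bsub>C\<^esub> \<alpha>) (hom C (one C) Xxy) (right_arrows C y x)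
    \<and> (\<exists>\<phi> \<psi>. bij_betw \<phi> (hom C (one C) Xxy) (left_hom C x y)
        \<and> bij_betw \<psi> (left_hom C x y) (right_hom C y x)
        \<and> (\<forall>\<alpha> \<in> hom C (one C) Xxy.
              \<phi> \<alpha> \<odot>\<^bsub>C\<^esub> slice_point C x = q \<odot>\<^bsub>C\<^esub> ixy \<odot>\<^bsub>C\<^esub> \<alpha>
            \<and> \<psi> (\<phi> \<alpha>) \<odot>\<^bsub>C\<^esub> coslice_point C y = p \<odot>\<^bsub>C\<^esub> exy \<odot>\<^bsub>C\<^esub> \<alpha>))"
proof -
  let ?A = "hom C (one C) Xxy"
  let ?l = "\<lambda>u. u \<odot>\<^bsub>C\<^esub> slice_point C x" and ?r = "\<lambda>u. u \<odot>\<^bsub>C\<^esub> coslice_point C y"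
  let ?f = "\<lambda>\<alpha>. q \<odot>\<^bsub>C\<^esub> ixy \<odot>\<^bsub>C\<^esub> \<alpha>" and ?g = "\<lambda>\<alpha>. p \<odot>\<^bsub>C\<^esub> exy \<odot>\<^bsub>C\<^esub> \<alpha>"
  note swap = swap_systems_bfc[OF assms(1)]
  have f: "bij_betw ?f ?A (left_arrows C x y)"
    unfolding assms(9) by (rule points_bij_left_arrows[OF assms(1,3,4,5,6,7)])
  have g: "bij_betw ?g ?A (right_arrows C y x)"
    unfolding assms(10)
    \<comment> \<open>In the swapped category the roles of \<open>x\<close> and \<open>y\<close> and
      of \<open>p\<close> and \<open>q\<close> are exchanged, and left arrows from \<open>y\<close>
      to \<open>x\<close> are right arrows of the original.\<close>
    using points_bij_left_arrows[OF swap, of y X x P q p Xxy c S' e t]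
      assms(3,4,6,8) pullback_sym[OF assms(5)] swap_systems_reflection[OF assms(1)] by simp
  have l: "bij_betw ?l (left_hom C x y) (left_arrows C x y)"
    by (rule left_hom_bij_left_arrows[OF assms(1,3,4)])
  have r: "bij_betw ?r (right_hom C y x) (right_arrows C y x)"
    using left_hom_bij_left_arrows[OF swap, of y X x] assms(3,4) by simp
  define \<phi> where "\<phi> = inv_into (left_hom C x y) ?l \<circ> ?f"
  \<comment> \<open>The required equation prescribes \<psi> at \<phi> \<alpha>, so \<phi> is undone
    first; the resulting element is sent to its right arrow, which is read as an arrow between
    coslices.\<close>
  define \<psi> where "\<psi> = inv_into (right_hom C y x) ?r \<circ> ?g \<circ> inv_into ?A \<phi>"
  have \<phi>: "bij_betw \<phi> ?A (left_hom C x y)"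
    unfolding \<phi>_def by (rule bij_betw_trans[OF f bij_betw_inv_into[OF l]])
  have \<psi>: "bij_betw \<psi> (left_hom C x y) (right_hom C y x)"
    unfolding \<psi>_def comp_assoc
    by (intro bij_betw_trans[OF bij_betw_trans[OF bij_betw_inv_into[OF \<phi>] g] bij_betw_inv_into[OF r],
          unfolded comp_assoc])
  have "?l (\<phi> \<alpha>) = ?f \<alpha> \<and> ?r (\<psi> (\<phi> \<alpha>)) = ?g \<alpha>" if a: "\<alpha> \<in> ?A" for \<alpha>
    using bij_betw_inv_into_right[OF l bij_betw_apply[OF f a]]
      bij_betw_inv_into_right[OF r bij_betw_apply[OF g a]] bij_betw_inv_into_left[OF \<phi> a]
    by (simp add: \<phi>_def \<psi>_def)
  with f g \<phi> \<psi> show ?thesis by blast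
qed

end
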